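(* Let $R$ be a Mori domain with quotient field $K$, $R\neq K$. The following conditions are equivalent: (1) $R$ is a $w$-divisorial domain; (2) each two generated nonzero ideal of $R$ is $w$-divisorial; (3) $R$ has $t$-dimension one and $(R:M)$ is a two $w$-generated (fractional) ideal for each $M\in t\text{-Max}(R)$.
   Context: For fractional ideals $I,J$ of $R$ put $(J:I)=\{x\in K: xI\subseteq J\}$. For a nonzero fractional ideal $I$: $I_v=(R:(R:I))$; $I_t=\bigcup J_v$, the union over nonzero finitely generated fractional ideals $J\subseteq I$. $I$ is divisorial if $I=I_v$, a $t$-ideal if $I=I_t$. A $t$-prime is a nonzero prime ideal that is a $t$-ideal; a $t$-maximal ideal is an ideal maximal among the proper integral $t$-ideals (it is prime); $t\text{-Max}(R)$ is the set of these. $I_w=\bigcap_{M\in t\text{-Max}(R)}IR_M$, and $I$ is a $w$-ideal if $I=I_w$. $R$ is Mori if it satisfies the ascending chain condition on proper divisorial ideals. $R$ is a $w$-divisorial domain if every $w$-ideal is divisorial. A nonzero fractional ideal $I$ is $w$-divisorial if $I_v=I_w$. $I$ is $n$ $w$-generated if $I_w=(a_1R+\dots+a_nR)_w$ for some $a_1,\dots,a_n\in K$. $R$ has $t$-dimension one if each $t$-prime ideal has height one. "Two generated" means generated by (at most) two elements. *)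

theory Defs
  imports Complex_Main "HOL-Library.Extended_Nat"
begin

text \<open>
  A domain is a subring \<open>R\<close> of a field type \<open>'k\<close>, and its quotient field \<open>K\<close> is the whole type
  (\<open>K = UNIV\<close>).  Ideals, fractional ideals and localizations are then subsets of \<open>'k\<close>.
  The predicates \<open>divisorial\<close>, \<open>t_ideal\<close>, \<open>w_ideal\<close>, \<open>w_divisorial\<close> and \<open>w_generated\<close> include
  the requirement that the set is a nonzero fractional ideal, since the closure
  operations below are only meaningful for those.
\<close>

definition subring :: "'k::field set \<Rightarrow> bool" where
  "subring R \<longleftrightarrow> 0 \<in> R \<and> 1 \<in> R \<and> (\<forall>x\<in>R. \<forall>y\<in>R. x - y \<in> R \<and> x * y \<in> R)"

definition has_quotient_field_UNIV :: "'k::field set \<Rightarrow> bool" where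
  "has_quotient_field_UNIV R \<longleftrightarrow> subring R \<and> (\<forall>x. \<exists>a\<in>R. \<exists>b\<in>R. b \<noteq> 0 \<and> x = a / b)"

definition submodule :: "'k::field set \<Rightarrow> 'k set \<Rightarrow> bool" where
  "submodule R I \<longleftrightarrow> 0 \<in> I \<and> (\<forall>x\<in>I. \<forall>y\<in>I. x + y \<in> I) \<and> (\<forall>r\<in>R. \<forall>x\<in>I. r * x \<in> I)"

definition fractional_ideal :: "'k::field set \<Rightarrow> 'k set \<Rightarrow> bool" where
  "fractional_ideal R I \<longleftrightarrow> submodule R I \<and> (\<exists>d\<in>R. d \<noteq> 0 \<and> (\<forall>x\<in>I. d * x \<in> R))"

definition nonzero_fractional_ideal :: "'k::field set \<Rightarrow> 'k set \<Rightarrow> bool" where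
  "nonzero_fractional_ideal R I \<longleftrightarrow> fractional_ideal R I \<and> I \<noteq> {0}"

definition integral_ideal :: "'k::field set \<Rightarrow> 'k set \<Rightarrow> bool" where
  "integral_ideal R I \<longleftrightarrow> submodule R I \<and> I \<subseteq> R"

definition prime_ideal :: "'k::field set \<Rightarrow> 'k set \<Rightarrow> bool" where
  "prime_ideal R P \<longleftrightarrow> integral_ideal R P \<and> P \<noteq> R \<and>
     (\<forall>x\<in>R. \<forall>y\<in>R. x * y \<in> P \<longrightarrow> x \<in> P \<or> y \<in> P)"

text \<open>\<open>generated R n a\<close> is \<open>a\<^sub>0 R + \<dots> + a\<^sub>n\<^sub>-\<^sub>1 R\<close>; the \<open>a\<^sub>i\<close> need not be distinct or nonzero, so
  it covers all submodules generated by at most \<open>n\<close> elements.\<close>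

definition generated :: "'k::field set \<Rightarrow> nat \<Rightarrow> (nat \<Rightarrow> 'k) \<Rightarrow> 'k set" where
  "generated R n a = {(\<Sum>i<n. r i * a i) | r. \<forall>i<n. r i \<in> R}"

definition finitely_generated :: "'k::field set \<Rightarrow> 'k set \<Rightarrow> bool" where
  "finitely_generated R I \<longleftrightarrow> (\<exists>n a. I = generated R n a)"

definition two_generated :: "'k::field set \<Rightarrow> 'k set \<Rightarrow> bool" where
  "two_generated R I \<longleftrightarrow> (\<exists>a. I = generated R 2 a)"

definition colon :: "'k::field set \<Rightarrow> 'k set \<Rightarrow> 'k set" where
  "colon J I = {x. \<forall>y\<in>I. x * y \<in> J}"

definition module_product :: "'k::field set \<Rightarrow> 'k set \<Rightarrow> 'k set" where
  "module_product I J =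
     {(\<Sum>i<n. x i * y i) | (n::nat) x y. (\<forall>i<n. x i \<in> I) \<and> (\<forall>i<n. y i \<in> J)}"

definition localization :: "'k::field set \<Rightarrow> 'k set \<Rightarrow> 'k set" where
  "localization R P = {a / s | a s. a \<in> R \<and> s \<in> R - P}"

definition v_closure :: "'k::field set \<Rightarrow> 'k set \<Rightarrow> 'k set" where
  "v_closure R I = colon R (colon R I)"

definition t_closure :: "'k::field set \<Rightarrow> 'k set \<Rightarrow> 'k set" where
  "t_closure R I =
     \<Union>{v_closure R J | J. nonzero_fractional_ideal R J \<and> finitely_generated R J \<and> J \<subseteq> I}"

definition divisorial :: "'k::field set \<Rightarrow> 'k set \<Rightarrow> bool" where
  "divisorial R I \<longleftrightarrow> nonzero_fractional_ideal R I \<and> I = v_closure R I"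

definition t_ideal :: "'k::field set \<Rightarrow> 'k set \<Rightarrow> bool" where
  "t_ideal R I \<longleftrightarrow> nonzero_fractional_ideal R I \<and> I = t_closure R I"

definition t_prime :: "'k::field set \<Rightarrow> 'k set \<Rightarrow> bool" where
  "t_prime R P \<longleftrightarrow> prime_ideal R P \<and> t_ideal R P"

definition proper_integral_t_ideal :: "'k::field set \<Rightarrow> 'k set \<Rightarrow> bool" where
  "proper_integral_t_ideal R I \<longleftrightarrow> integral_ideal R I \<and> I \<noteq> R \<and> t_ideal R I"

definition t_Max :: "'k::field set \<Rightarrow> 'k set set" where
  "t_Max R = {M. proper_integral_t_ideal R M \<and>
                 (\<forall>I. proper_integral_t_ideal R I \<and> M \<subseteq> I \<longrightarrow> I = M)}"

definition w_closure :: "'k::field set \<Rightarrow> 'k set \<Rightarrow> 'k set" where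
  "w_closure R I = (\<Inter>M\<in>t_Max R. module_product I (localization R M))"

definition w_ideal :: "'k::field set \<Rightarrow> 'k set \<Rightarrow> bool" where
  "w_ideal R I \<longleftrightarrow> nonzero_fractional_ideal R I \<and> I = w_closure R I"

definition w_divisorial :: "'k::field set \<Rightarrow> 'k set \<Rightarrow> bool" where
  "w_divisorial R I \<longleftrightarrow> nonzero_fractional_ideal R I \<and> v_closure R I = w_closure R I"

definition w_generated :: "'k::field set \<Rightarrow> nat \<Rightarrow> 'k set \<Rightarrow> bool" where
  "w_generated R n I \<longleftrightarrow> nonzero_fractional_ideal R I \<and>
     (\<exists>a. w_closure R I = w_closure R (generated R n a))"

definition Mori_domain :: "'k::field set \<Rightarrow> bool" where
  "Mori_domain R \<longleftrightarrow> has_quotient_field_UNIV R \<and>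
     (\<forall>I :: nat \<Rightarrow> 'k set.
        (\<forall>n. integral_ideal R (I n) \<and> I n \<noteq> R \<and> divisorial R (I n)) \<and>
        (\<forall>n. I n \<subseteq> I (Suc n)) \<longrightarrow> (\<exists>N. \<forall>n\<ge>N. I n = I N))"

definition w_divisorial_domain :: "'k::field set \<Rightarrow> bool" where
  "w_divisorial_domain R \<longleftrightarrow> (\<forall>I. w_ideal R I \<longrightarrow> divisorial R I)"

definition height :: "'k::field set \<Rightarrow> 'k set \<Rightarrow> enat" where
  "height R P = Sup {enat n | n. \<exists>Q :: nat \<Rightarrow> 'k set.
     (\<forall>i\<le>n. prime_ideal R (Q i)) \<and> (\<forall>i<n. Q i \<subset> Q (Suc i)) \<and> Q n = P}"

definition t_dimension_one :: "'k::field set \<Rightarrow> bool" where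
  "t_dimension_one R \<longleftrightarrow> (\<forall>P. t_prime R P \<longrightarrow> height R P = 1)"

end

theory Submission
  imports Defs
begin

text \<open>
  In a Mori domain the \<open>t\<close>- and \<open>v\<close>-operations agree, and for \<open>M \<in> t_Max R\<close> an element
  outside a divisorial \<open>D\<close> that \<open>M\<close> multiplies into \<open>D\<close> has conductor exactly \<open>M\<close>.

  (2) to (3): for \<open>0 \<noteq> x \<in> Q\<close> and \<open>a \<in> P - Q\<close> with \<open>Q \<subset> P \<subseteq> M\<close> primes, the ideals
  \<open>(x, a\<^sup>n)\<^sub>v\<close> descend and contain \<open>x\<close>, so they stabilize, which locally at \<open>M\<close> puts a power of \<open>a\<close>
  into \<open>Q\<close>. Moreover \<open>(R : M) = (1, y)\<^sub>v\<close> for every \<open>y \<in> (R : M) - R\<close>.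

  (3) to (1): let \<open>D\<close> be a maximal divisorial ideal inside a \<open>w\<close>-ideal \<open>I\<close>. If \<open>D \<noteq> I\<close>, a
  maximal conductor into \<open>D\<close> of an element of \<open>I - D\<close> is a \<open>t\<close>-prime, hence some
  \<open>M \<in> t_Max R\<close> by the dimension hypothesis; so \<open>M b \<subseteq> D\<close> for some \<open>b \<in> I - D\<close>. Since
  \<open>(R : M) / R\<close> is simple locally at \<open>M\<close>, a duality argument shows that \<open>D + b R\<close> is
  \<open>w\<close>-divisorial, so \<open>(D + b R)\<^sub>v \<subseteq> I\<close>, contradicting maximality.
\<close>

section \<open>Colon ideals and the divisorial closure over an arbitrary domain\<close>

locale quotient_domain =
  fixes R :: "'k::field set"
  assumes qf: "has_quotient_field_UNIV R"
begin

lemma zero_mem [simp, intro]: "0 \<in> R"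
  and one_mem [simp, intro]: "1 \<in> R"
  and diff_mem [intro]: "x \<in> R \<Longrightarrow> y \<in> R \<Longrightarrow> x - y \<in> R"
  and mult_mem [intro]: "x \<in> R \<Longrightarrow> y \<in> R \<Longrightarrow> x * y \<in> R"
  using qf unfolding has_quotient_field_UNIV_def subring_def by blast+

lemma uminus_mem [intro]: "x \<in> R \<Longrightarrow> - x \<in> R"
  using diff_mem[of 0 x] by simp

lemma add_mem [intro]: "x \<in> R \<Longrightarrow> y \<in> R \<Longrightarrow> x + y \<in> R"
  using diff_mem[of x "- y"] by auto

lemma power_mem [intro]: "x \<in> R \<Longrightarrow> x ^ n \<in> R"
  by (induction n) auto

lemma denominator_obtain:
  obtains q where "q \<in> R" "q \<noteq> 0" "q * x \<in> R"
proof -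
  obtain a b where "a \<in> R" "b \<in> R" "b \<noteq> 0" "x = a / b"
    using qf unfolding has_quotient_field_UNIV_def by blast
  then show ?thesis
    using that[of b] by simp
qed

lemma submodule_add: "submodule R I \<Longrightarrow> x \<in> I \<Longrightarrow> y \<in> I \<Longrightarrow> x + y \<in> I"
  and submodule_mult: "submodule R I \<Longrightarrow> r \<in> R \<Longrightarrow> x \<in> I \<Longrightarrow> r * x \<in> I"
  and submodule_zero: "submodule R I \<Longrightarrow> 0 \<in> I"
  unfolding submodule_def by blast+

lemma submodule_diff: "submodule R I \<Longrightarrow> x \<in> I \<Longrightarrow> y \<in> I \<Longrightarrow> x - y \<in> I"
  using submodule_add[of I x "(-1) * y"] submodule_mult[of I "-1" y] by auto

lemma submodule_ring: "submodule R R"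
  unfolding submodule_def by auto

lemma submodule_colon: "submodule R J \<Longrightarrow> submodule R (colon J I)"
  unfolding submodule_def colon_def by (auto simp: algebra_simps)

lemma colon_antimono: "I \<subseteq> I' \<Longrightarrow> colon J I' \<subseteq> colon J I"
  unfolding colon_def by blast

lemma subset_v_closure: "I \<subseteq> v_closure R I"
  unfolding v_closure_def colon_def by (auto simp: mult.commute)

lemma v_closure_mono: "I \<subseteq> J \<Longrightarrow> v_closure R I \<subseteq> v_closure R J"
  unfolding v_closure_def by (intro colon_antimono)

text \<open>The map sending \<open>I\<close> to \<open>(R : I)\<close> is an antitone Galois
  connection with itself, so three applications collapse to one.\<close>

lemma colon_v_closure: "colon R (v_closure R I) = colon R I"
  using subset_v_closure[of I] subset_v_closure[of "colon R I"] colon_antimono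
  unfolding v_closure_def by blast

lemma v_closure_idem: "v_closure R (v_closure R I) = v_closure R I"
  using colon_v_closure[of I] unfolding v_closure_def by simp

lemma v_closure_colon: "v_closure R (colon R I) = colon R I"
  using colon_v_closure[of I] unfolding v_closure_def by simp

lemma submodule_v_closure: "submodule R (v_closure R I)"
  unfolding v_closure_def by (intro submodule_colon submodule_ring)

lemma nonzero_elem:
  assumes "nonzero_fractional_ideal R I"
  obtains x where "x \<in> I" "x \<noteq> 0"
  using assms submodule_zero
  unfolding nonzero_fractional_ideal_def fractional_ideal_def by blast

lemma nonzero_integral_elem:
  assumes "nonzero_fractional_ideal R I"
  obtains x where "x \<in> I" "x \<in> R" "x \<noteq> 0"
proof -
  obtain x where x: "x \<in> I" "x \<noteq> 0"
    using nonzero_elem assms .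
  obtain q where q: "q \<in> R" "q \<noteq> 0" "q * x \<in> R"
    using denominator_obtain .
  have "q * x \<in> I"
    using assms x q submodule_mult
    unfolding nonzero_fractional_ideal_def fractional_ideal_def by blast
  with x q show ?thesis
    using that[of "q * x"] by simp
qed

lemma submoduleD: "nonzero_fractional_ideal R I \<Longrightarrow> submodule R I"
  unfolding nonzero_fractional_ideal_def fractional_ideal_def by blast

lemma nonzero_fractional_ideal_sandwich:
  assumes "submodule R J" "x \<in> J" "x \<noteq> 0" "J \<subseteq> I" "nonzero_fractional_ideal R I"
  shows "nonzero_fractional_ideal R J"
  using assms unfolding nonzero_fractional_ideal_def fractional_ideal_def by blast

lemma nonzero_fractional_ideal_ring: "nonzero_fractional_ideal R R"
proof -
  have "R \<noteq> {0}"
    by (metis one_mem singletonD zero_neq_one)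
  then show ?thesis
    using submodule_ring one_mem zero_neq_one mult_mem
    unfolding nonzero_fractional_ideal_def fractional_ideal_def by metis
qed

lemma nonzero_fractional_ideal_integral:
  assumes "integral_ideal R I" "x \<in> I" "x \<noteq> 0"
  shows "nonzero_fractional_ideal R I"
  using nonzero_fractional_ideal_sandwich[OF _ assms(2,3) _ nonzero_fractional_ideal_ring] assms(1)
  unfolding integral_ideal_def by blast

text \<open>A common denominator of \<open>I\<close> is a nonzero element of \<open>(R : I)\<close>,
  and a nonzero element of \<open>I\<close> inside \<open>R\<close> is a common denominator of
  \<open>(R : I)\<close>.\<close>

lemma nonzero_fractional_ideal_colon:
  assumes "nonzero_fractional_ideal R I"
  shows "nonzero_fractional_ideal R (colon R I)"
proof -
  obtain x where x: "x \<in> I" "x \<in> R" "x \<noteq> 0"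
    using nonzero_integral_elem assms .
  obtain d where "d \<in> R" "d \<noteq> 0" "\<forall>x\<in>I. d * x \<in> R"
    using assms unfolding nonzero_fractional_ideal_def fractional_ideal_def by blast
  then have "d \<in> colon R I" "d \<noteq> 0"
    unfolding colon_def by auto
  moreover have "\<forall>y\<in>colon R I. x * y \<in> R"
    using x unfolding colon_def by (auto simp: mult.commute)
  ultimately show ?thesis
    using x submodule_colon[OF submodule_ring]
    unfolding nonzero_fractional_ideal_def fractional_ideal_def by blast
qed

lemma divisorial_v_closure: "nonzero_fractional_ideal R I \<Longrightarrow> divisorial R (v_closure R I)"
  unfolding divisorial_def v_closure_idem
  by (simp add: nonzero_fractional_ideal_colon v_closure_def)

lemma divisorial_colon: "nonzero_fractional_ideal R I \<Longrightarrow> divisorial R (colon R I)"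
  unfolding divisorial_def v_closure_colon
  by (simp add: nonzero_fractional_ideal_colon)

lemma divisorial_ring: "divisorial R R"
proof -
  have "v_closure R R \<subseteq> R"
    unfolding v_closure_def colon_def by force
  then show ?thesis
    unfolding divisorial_def using nonzero_fractional_ideal_ring subset_v_closure by blast
qed

text \<open>Scaling by \<open>d\<close> is an \<open>R\<close>-linear automorphism of the field. It
  moves families of fractional ideals into \<open>R\<close>, where the Mori condition speaks, and
  shows that nonzero principal ideals are divisorial.\<close>

lemma divisorial_scale:
  assumes D: "divisorial R D" and d: "d \<noteq> 0"
  shows "divisorial R ((*) d ` D)"
proof -
  \<comment> \<open>Rewriting the image as a preimage under \<open>inverse d\<close> turns
    membership into a plain condition on elements.\<close>
  have eq: "(*) d ` A = {x. inverse d * x \<in> A}" for A :: "'k set"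
    using d by (auto simp: image_iff field_simps intro!: bexI[of _ "_ / d"])
  have D': "nonzero_fractional_ideal R D" "D = v_closure R D"
    using D unfolding divisorial_def by auto
  obtain x where x: "x \<in> D" "x \<noteq> 0"
    using nonzero_elem D'(1) .
  obtain e where e: "e \<in> R" "e \<noteq> 0" "\<forall>x\<in>D. e * x \<in> R"
    using D'(1) unfolding nonzero_fractional_ideal_def fractional_ideal_def by blast
  obtain q where q: "q \<in> R" "q \<noteq> 0" "q * d \<in> R"
    using denominator_obtain .
  have "submodule R ((*) d ` D)"
    using submoduleD[OF D'(1)] unfolding eq submodule_def
    by (auto simp: algebra_simps)
  moreover have "\<forall>x\<in>(*) d ` D. (q * e) * x \<in> R"
  proof clarify
    fix x assume "x \<in> D"
    then have "(q * d) * (e * x) \<in> R"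
      using q e by blast
    then show "(q * e) * (d * x) \<in> R"
      by (simp add: ac_simps)
  qed
  moreover have "d * x \<in> (*) d ` D" "d * x \<noteq> 0"
    using x d by auto
  ultimately have nf: "nonzero_fractional_ideal R ((*) d ` D)"
    unfolding nonzero_fractional_ideal_def fractional_ideal_def
    using q e mult_mem[of q e] by (metis mult_eq_0_iff singletonD)
  have "y \<in> (*) d ` D" if y: "y \<in> v_closure R ((*) d ` D)" for y
  proof -
    have "inverse d * y \<in> v_closure R D"
      unfolding v_closure_def colon_def[of R "colon R D"]
    proof safe
      fix f assume "f \<in> colon R D"
      then have "f * inverse d \<in> colon R ((*) d ` D)"
        using d unfolding colon_def by (auto simp: field_simps)
      then have "y * (f * inverse d) \<in> R"
        using y unfolding v_closure_def colon_def by blast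
      then show "inverse d * y * f \<in> R"
        by (simp add: ac_simps)
    qed
    then show ?thesis
      using D'(2) unfolding eq by simp
  qed
  then show ?thesis
    unfolding divisorial_def using nf subset_v_closure by blast
qed

section \<open>Conductors of elements into a divisorial ideal\<close>

definition transporter :: "'k set \<Rightarrow> 'k \<Rightarrow> 'k set" where
  "transporter D z = {u \<in> R. u * z \<in> D}"

lemma integral_transporter: "submodule R D \<Longrightarrow> integral_ideal R (transporter D z)"
  unfolding integral_ideal_def submodule_def transporter_def
  by (auto simp: algebra_simps)

lemma transporter_eq_ring_iff: "submodule R D \<Longrightarrow> transporter D z = R \<longleftrightarrow> z \<in> D"
  unfolding transporter_def submodule_def using one_mem by force

text \<open>The transporter is the annihilator of the class of \<open>z\<close> modulo
  \<open>D\<close>. It is cut out by multipliers into \<open>R\<close>: the element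
  \<open>1\<close>, and \<open>f * z\<close> for every \<open>f\<close> in \<open>(R : D)\<close>.
  Sets of this kind are divisorial.\<close>

lemma divisorial_transporter:
  assumes D: "divisorial R D"
  shows "divisorial R (transporter D z)"
proof -
  let ?A = "transporter D z"
  have nfD: "nonzero_fractional_ideal R D" and Dv: "D = v_closure R D"
    using D unfolding divisorial_def by auto
  obtain d where d: "d \<in> D" "d \<in> R" "d \<noteq> 0"
    using nonzero_integral_elem nfD .
  obtain q where q: "q \<in> R" "q \<noteq> 0" "q * z \<in> R"
    using denominator_obtain .
  have "(q * d) * z = (q * z) * d"
    by simp
  also have "\<dots> \<in> D"
    using submodule_mult[OF submoduleD[OF nfD] q(3) d(1)] .
  finally have "q * d \<in> ?A"
    unfolding transporter_def using q d by auto
  then have nf: "nonzero_fractional_ideal R ?A"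
    using nonzero_fractional_ideal_integral integral_transporter[OF submoduleD[OF nfD]] q d
    by (metis mult_eq_0_iff)
  have "u \<in> ?A" if u: "u \<in> v_closure R ?A" for u
  proof -
    have "1 \<in> colon R ?A"
      unfolding colon_def transporter_def by simp
    then have "u \<in> R"
      using u unfolding v_closure_def colon_def by force
    moreover have "u * z \<in> v_closure R D"
      unfolding v_closure_def colon_def[of R "colon R D"]
    proof safe
      fix f assume f: "f \<in> colon R D"
      have "f * z \<in> colon R ?A"
        using f unfolding colon_def transporter_def by (auto simp: ac_simps)
      then have "u * (f * z) \<in> R"
        using u unfolding v_closure_def colon_def by blast
      then show "u * z * f \<in> R"
        by (simp add: ac_simps)
    qed
    ultimately show ?thesis
      using Dv unfolding transporter_def by blast
  qed
  then show ?thesis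
    unfolding divisorial_def using nf subset_v_closure by blast
qed

section \<open>Two generated and finitely generated submodules\<close>

definition pair_ideal :: "'k \<Rightarrow> 'k \<Rightarrow> 'k set" where
  "pair_ideal x y = {r * x + s * y | r s. r \<in> R \<and> s \<in> R}"

text \<open>Two explicit coefficients replace the indexed sum in all later computations.\<close>

lemma generated_2: "generated R 2 a = pair_ideal (a 0) (a 1)"
proof (intro set_eqI iffI)
  fix z assume "z \<in> generated R 2 a"
  then show "z \<in> pair_ideal (a 0) (a 1)"
    unfolding generated_def pair_ideal_def by (auto simp: eval_nat_numeral)
next
  fix z assume "z \<in> pair_ideal (a 0) (a 1)"
  then obtain r s where "r \<in> R" "s \<in> R" "z = r * a 0 + s * a 1"
    unfolding pair_ideal_def by blast
  then show "z \<in> generated R 2 a"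
    unfolding generated_def
    by (auto simp: eval_nat_numeral less_Suc_eq intro!: exI[of _ "\<lambda>i. if i = 0 then r else s"])
qed

lemma pair_ideal_generated: "pair_ideal x y = generated R 2 (\<lambda>i. if i = 0 then x else y)"
  by (simp add: generated_2)

lemma submodule_generated: "submodule R (generated R n a)"
  unfolding submodule_def
proof (intro conjI ballI)
  show "0 \<in> generated R n a"
    unfolding generated_def by (auto intro!: exI[of _ "\<lambda>_. 0"])
next
  fix x y assume "x \<in> generated R n a" "y \<in> generated R n a"
  then obtain r s where "\<forall>i<n. r i \<in> R" "x = (\<Sum>i<n. r i * a i)"
    "\<forall>i<n. s i \<in> R" "y = (\<Sum>i<n. s i * a i)"
    unfolding generated_def by blast
  then have "x + y = (\<Sum>i<n. (r i + s i) * a i)" "\<forall>i<n. r i + s i \<in> R"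
    by (auto simp: sum.distrib distrib_right)
  then show "x + y \<in> generated R n a"
    unfolding generated_def by (auto intro!: exI[of _ "\<lambda>i. r i + s i"])
next
  fix c x assume "c \<in> R" "x \<in> generated R n a"
  then obtain r where "\<forall>i<n. r i \<in> R" "x = (\<Sum>i<n. r i * a i)"
    unfolding generated_def by blast
  then have "c * x = (\<Sum>i<n. (c * r i) * a i)" "\<forall>i<n. c * r i \<in> R"
    using \<open>c \<in> R\<close> by (auto simp: sum_distrib_left mult.assoc)
  then show "c * x \<in> generated R n a"
    unfolding generated_def by (auto intro!: exI[of _ "\<lambda>i. c * r i"])
qed

lemma submodule_pair: "submodule R (pair_ideal x y)"
  unfolding pair_ideal_generated by (rule submodule_generated)

lemma pair_idealI: "r \<in> R \<Longrightarrow> s \<in> R \<Longrightarrow> r * x + s * y \<in> pair_ideal x y"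
  unfolding pair_ideal_def by blast

lemma pair_ideal_left: "x \<in> pair_ideal x y"
  using pair_idealI[of 1 0 x y] by simp

lemma pair_ideal_right: "y \<in> pair_ideal x y"
  using pair_idealI[of 0 1 x y] by simp

text \<open>This lets a maximal closure of a finitely generated submodule of \<open>I\<close> absorb
  every element of \<open>I\<close>.\<close>

lemma generated_insert:
  assumes "submodule R I" "generated R n a \<subseteq> I" "x \<in> I"
  obtains b where "generated R n a \<subseteq> generated R (Suc n) b" "x \<in> generated R (Suc n) b"
    "generated R (Suc n) b \<subseteq> I"
proof -
  let ?b = "a(n := x)"
  have split: "(\<Sum>i<Suc n. r i * ?b i) = (\<Sum>i<n. r i * a i) + r n * x" for r :: "nat \<Rightarrow> 'k"
    by simp
  have "generated R n a \<subseteq> generated R (Suc n) ?b"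
  proof
    fix y assume "y \<in> generated R n a"
    then obtain r where r: "\<forall>i<n. r i \<in> R" "y = (\<Sum>i<n. r i * a i)"
      unfolding generated_def by blast
    let ?r = "r(n := 0)"
    have "y = (\<Sum>i<Suc n. ?r i * ?b i)"
      unfolding split using r by simp
    moreover have "\<forall>i<Suc n. ?r i \<in> R"
      using r by (auto simp: less_Suc_eq)
    ultimately show "y \<in> generated R (Suc n) ?b"
      unfolding generated_def by blast
  qed
  moreover have "x \<in> generated R (Suc n) ?b"
  proof -
    let ?r = "(\<lambda>_. 0)(n := 1)"
    have "x = (\<Sum>i<Suc n. ?r i * ?b i)"
      unfolding split by simp
    moreover have "\<forall>i<Suc n. ?r i \<in> R"
      by (auto simp: less_Suc_eq)
    ultimately show ?thesis
      unfolding generated_def by blast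
  qed
  moreover have "generated R (Suc n) ?b \<subseteq> I"
  proof
    fix y assume "y \<in> generated R (Suc n) ?b"
    then obtain r where r: "\<forall>i<Suc n. r i \<in> R" "y = (\<Sum>i<n. r i * a i) + r n * x"
      unfolding generated_def split by blast
    then have "(\<Sum>i<n. r i * a i) \<in> generated R n a"
      unfolding generated_def by auto
    then show "y \<in> I"
      using r assms submodule_add submodule_mult by blast
  qed
  ultimately show ?thesis
    using that by blast
qed

section \<open>Enlarging a submodule by one element, and membership in a localized module\<close>

definition adjoin :: "'k set \<Rightarrow> 'k \<Rightarrow> 'k set" where
  "adjoin D b = {d + r * b | d r. d \<in> D \<and> r \<in> R}"

lemma adjoinI: "d \<in> D \<Longrightarrow> r \<in> R \<Longrightarrow> d + r * b \<in> adjoin D b"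
  unfolding adjoin_def by blast

lemma subset_adjoin: "D \<subseteq> adjoin D b"
  using adjoinI[of _ D 0 b] by auto

lemma adjoin_mem: "submodule R D \<Longrightarrow> b \<in> adjoin D b"
  using adjoinI[of 0 D 1 b] submodule_zero by auto

lemma submodule_adjoin:
  assumes D: "submodule R D"
  shows "submodule R (adjoin D b)"
  unfolding submodule_def
proof (intro conjI ballI)
  show "0 \<in> adjoin D b"
    using subset_adjoin submodule_zero[OF D] by blast
next
  fix x y assume "x \<in> adjoin D b" "y \<in> adjoin D b"
  then obtain d r d' r' where "d \<in> D" "r \<in> R" "x = d + r * b" "d' \<in> D" "r' \<in> R" "y = d' + r' * b"
    unfolding adjoin_def by blast
  then show "x + y \<in> adjoin D b"
    using adjoinI[of "d + d'" D "r + r'" b] submodule_add[OF D] add_mem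
    by (simp add: algebra_simps)
next
  fix c x assume "c \<in> R" "x \<in> adjoin D b"
  then obtain d r where "d \<in> D" "r \<in> R" "x = d + r * b"
    unfolding adjoin_def by blast
  then show "c * x \<in> adjoin D b"
    using adjoinI[of "c * d" D "c * r" b] submodule_mult[OF D \<open>c \<in> R\<close>] \<open>c \<in> R\<close> mult_mem
    by (simp add: algebra_simps)
qed

text \<open>A finite sum has a common denominator, and it stays outside \<open>M\<close> because
  \<open>M\<close> is prime. This reduces localization to a statement about elements.\<close>

lemma mem_module_product_localization_iff:
  assumes I: "submodule R I" and M: "prime_ideal R M"
  shows "x \<in> module_product I (localization R M) \<longleftrightarrow> (\<exists>s\<in>R - M. s * x \<in> I)"
proof
  have one: "1 \<in> R - M"
    using M submodule_mult[of M _ 1] unfolding prime_ideal_def integral_ideal_def by auto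
  assume "x \<in> module_product I (localization R M)"
  then obtain n :: nat and f g where fg: "\<forall>i<n. f i \<in> I" "\<forall>i<n. g i \<in> localization R M"
    and x: "x = (\<Sum>i<n. f i * g i)"
    unfolding module_product_def by blast
  \<comment> \<open>The common denominator is collected one summand at a time.\<close>
  have "\<exists>s\<in>R - M. s * (\<Sum>i<k. f i * g i) \<in> I" if "k \<le> n" for k
    using that
  proof (induction k)
    case 0
    then show ?case
      using one submodule_zero[OF I] by auto
  next
    case (Suc k)
    then obtain s where s: "s \<in> R - M" "s * (\<Sum>i<k. f i * g i) \<in> I"
      by auto
    have "g k \<in> localization R M"
      using fg Suc.prems by simp
    then obtain a t where at: "a \<in> R" "t \<in> R - M" "g k = a / t"
      unfolding localization_def by blast
    have "t \<noteq> 0"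
      using at(2) M submodule_zero unfolding prime_ideal_def integral_ideal_def by auto
    then have "(s * t) * (\<Sum>i<Suc k. f i * g i) = t * (s * (\<Sum>i<k. f i * g i)) + (s * a) * f k"
      using at by (simp add: field_simps)
    moreover have "t * (s * (\<Sum>i<k. f i * g i)) \<in> I" "(s * a) * f k \<in> I"
      using s at fg Suc.prems by (auto intro!: submodule_mult[OF I])
    ultimately have "(s * t) * (\<Sum>i<Suc k. f i * g i) \<in> I"
      using submodule_add[OF I] by simp
    moreover have "s * t \<in> R - M"
      using s at M unfolding prime_ideal_def by blast
    ultimately show ?case
      by blast
  qed
  then show "\<exists>s\<in>R - M. s * x \<in> I"
    using x by blast
next
  assume "\<exists>s\<in>R - M. s * x \<in> I"
  then obtain s where s: "s \<in> R - M" "s * x \<in> I"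
    by blast
  then have "s \<noteq> 0"
    using M submodule_zero unfolding prime_ideal_def integral_ideal_def by auto
  then have "x = (\<Sum>i<1::nat. (s * x) * (1 / s))"
    by simp
  moreover have "1 / s \<in> localization R M"
    unfolding localization_def using s by blast
  ultimately show "x \<in> module_product I (localization R M)"
    unfolding module_product_def using s
    by (intro CollectI exI[of _ "1::nat"] exI[of _ "\<lambda>_. s * x"] exI[of _ "\<lambda>_. 1 / s"]) simp
qed

section \<open>Heights of prime ideals\<close>

lemma prime_ideal_zero: "prime_ideal R {0}"
proof -
  have "R \<noteq> {0}"
    by (metis one_mem singletonD zero_neq_one)
  then show ?thesis
    unfolding prime_ideal_def integral_ideal_def submodule_def by auto
qed

lemma height_ge:
  assumes "\<And>i. i \<le> n \<Longrightarrow> prime_ideal R (Q i)" "\<And>i. i < n \<Longrightarrow> Q i \<subset> Q (Suc i)" "Q n = P"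
  shows "enat n \<le> height R P"
  unfolding height_def using assms by (intro Sup_upper) blast

lemma height_ge_1:
  assumes "prime_ideal R P" "P \<noteq> {0}"
  shows "1 \<le> height R P"
proof -
  have "{0} \<subset> P"
    using assms submodule_zero unfolding prime_ideal_def integral_ideal_def by auto
  then have "enat 1 \<le> height R P"
    using assms prime_ideal_zero
    by (intro height_ge[of _ "\<lambda>i. if i = 0 then {0} else P"]) auto
  then show ?thesis
    by (simp add: one_enat_def)
qed

lemma height_one_minimal:
  assumes "height R P = 1" "prime_ideal R P" "prime_ideal R Q" "Q \<noteq> {0}" "Q \<subseteq> P"
  shows "Q = P"
proof (rule ccontr)
  assume "Q \<noteq> P"
  have "{0} \<subset> Q"
    using assms submodule_zero unfolding prime_ideal_def integral_ideal_def by auto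
  then have "enat 2 \<le> height R P"
    using assms prime_ideal_zero \<open>Q \<noteq> P\<close>
    by (intro height_ge[of _ "\<lambda>i. if i = 0 then {0} else if i = 1 then Q else P"])
       (auto simp: less_2_cases_iff)
  then show False
    using assms(1) by (simp add: one_enat_def)
qed

lemma height_le_1:
  assumes "\<And>Q. prime_ideal R Q \<Longrightarrow> Q \<subset> P \<Longrightarrow> Q = {0}"
  shows "height R P \<le> 1"
  unfolding height_def
proof (rule Sup_least, clarify)
  fix n and Q :: "nat \<Rightarrow> 'k set"
  assume Q: "\<forall>i\<le>n. prime_ideal R (Q i)" "\<forall>i<n. Q i \<subset> Q (Suc i)" "P = Q n"
  show "enat n \<le> 1"
  proof (rule ccontr)
    assume "\<not> enat n \<le> 1"
    then have "\<not> n \<le> 1"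
      by (simp add: one_enat_def)
    then obtain k where k: "n = Suc (Suc k)"
      by (metis One_nat_def Suc_le_mono le0 not0_implies_Suc)
    \<comment> \<open>The prime just below the top of the chain must be zero, which leaves no room
      for its strict predecessor \<open>Q k\<close>.\<close>
    then have "Q (Suc k) = {0}"
      using assms[of "Q (Suc k)"] Q by auto
    moreover have "Q k \<subset> Q (Suc k)" "0 \<in> Q k"
      using Q k submodule_zero unfolding prime_ideal_def integral_ideal_def by auto
    ultimately show False
      by auto
  qed
qed

end

section \<open>The Mori chain condition and the equality of the \<open>t\<close>- and
  \<open>v\<close>-operations\<close>

locale mori_domain = quotient_domain R for R :: "'k::field set" +
  assumes mori: "Mori_domain R"
begin

text \<open>The Mori condition is extended from proper integral ideals to fractional ideals with a
  common denominator \<open>d\<close>: without a maximal member there is a strict chain, and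
  \<open>d\<close> scales it into \<open>R\<close>.\<close>

lemma divisorial_maximal:
  assumes "S \<noteq> {}" and div: "\<And>D. D \<in> S \<Longrightarrow> divisorial R D"
    and d: "d \<noteq> 0" "\<And>D x. D \<in> S \<Longrightarrow> x \<in> D \<Longrightarrow> d * x \<in> R"
  shows "\<exists>D\<in>S. \<forall>E\<in>S. D \<subseteq> E \<longrightarrow> E = D"
proof (rule ccontr)
  assume "\<not> ?thesis"
  then have step: "\<exists>E. E \<in> S \<and> D \<subset> E" if "D \<in> S" for D
    using that by blast
  obtain D0 where "D0 \<in> S"
    using assms(1) by blast
  then obtain C where C: "\<And>n. C n \<in> S" "\<And>n. C n \<subset> C (Suc n)"
    using dependent_nat_choice[of "\<lambda>_ D. D \<in> S" "\<lambda>_ D E. D \<subset> E"] step by metis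
  let ?I = "\<lambda>n. (*) d ` C n"
  have strict: "?I n \<subset> ?I (Suc n)" for n
  proof -
    have "inj ((*) d)"
      using d(1) by (auto intro: injI)
    then show ?thesis
      using C(2)[of n] by (metis image_strict_mono inj_on_subset subset_UNIV)
  qed
  have sub: "?I n \<subseteq> R" for n
    using d(2) C(1) by blast
  have dv: "divisorial R (?I n)" for n
    using divisorial_scale div C(1) d(1) by blast
  have "submodule R (?I n)" for n
    using dv[of n] submoduleD unfolding divisorial_def by blast
  then have "integral_ideal R (?I n)" for n
    unfolding integral_ideal_def using sub[of n] by simp
  \<comment> \<open>Properness is free, since each term is strictly below the next one, which still
    lies in \<open>R\<close>.\<close>
  moreover have "?I n \<noteq> R" for n
    using strict[of n] sub[of "Suc n"] by blast
  moreover have "?I n \<subseteq> ?I (Suc n)" for n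
    using strict[of n] by simp
  ultimately have "\<exists>N. \<forall>n\<ge>N. ?I n = ?I N"
    using dv mori[unfolded Mori_domain_def, THEN conjunct2, rule_format, of ?I] by simp
  then obtain N where "?I (Suc N) = ?I N"
    by (meson le_SucI order_refl)
  then show False
    using strict[of N] by blast
qed

lemma t_closure_eq_v_closure:
  assumes I: "nonzero_fractional_ideal R I"
  shows "t_closure R I = v_closure R I"
proof
  show "t_closure R I \<subseteq> v_closure R I"
    unfolding t_closure_def using v_closure_mono by blast
next
  let ?F = "{J. nonzero_fractional_ideal R J \<and> finitely_generated R J \<and> J \<subseteq> I}"
  obtain x where x: "x \<in> I" "x \<in> R" "x \<noteq> 0"
    using nonzero_integral_elem I .
  have nf: "nonzero_fractional_ideal R (v_closure R I)"
    using divisorial_v_closure[OF I] unfolding divisorial_def by blast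
  \<comment> \<open>A denominator of the closure of \<open>I\<close> serves all closures of
    submodules of \<open>I\<close> at once.\<close>
  then obtain d where d: "d \<noteq> 0" "\<forall>x\<in>v_closure R I. d * x \<in> R"
    unfolding nonzero_fractional_ideal_def fractional_ideal_def by blast
  \<comment> \<open>The principal ideal \<open>x R\<close> shows that the family \<open>?F\<close>
    is nonempty.\<close>
  have "pair_ideal x 0 \<subseteq> I"
    using x(1) submodule_mult[OF submoduleD[OF I]] unfolding pair_ideal_def by auto
  then have "nonzero_fractional_ideal R (pair_ideal x 0)" "pair_ideal x 0 \<subseteq> I"
    using nonzero_fractional_ideal_sandwich[OF submodule_pair pair_ideal_left x(3) _ I] by blast+
  moreover have "finitely_generated R (pair_ideal x 0)"
    unfolding finitely_generated_def using pair_ideal_generated by blast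
  ultimately have "pair_ideal x 0 \<in> ?F"
    by blast
  then have "v_closure R ` ?F \<noteq> {}"
    by blast
  moreover have "divisorial R D" if "D \<in> v_closure R ` ?F" for D
    using that divisorial_v_closure by blast
  moreover have "d * x \<in> R" if "D \<in> v_closure R ` ?F" "x \<in> D" for D x
    using that d(2) v_closure_mono by blast
  ultimately have "\<exists>D\<in>v_closure R ` ?F. \<forall>E\<in>v_closure R ` ?F. D \<subseteq> E \<longrightarrow> E = D"
    using d(1) by (intro divisorial_maximal)
  then obtain D where D: "D \<in> v_closure R ` ?F"
    and max: "\<forall>E\<in>v_closure R ` ?F. D \<subseteq> E \<longrightarrow> E = D"
    by (rule bexE)
  then obtain J where J: "J \<in> ?F" "D = v_closure R J"
    by blast
  then obtain n a where J_gen: "J = generated R n a"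
    unfolding finitely_generated_def by blast
  have "I \<subseteq> D"
  proof
    fix y assume "y \<in> I"
    then obtain b where b: "J \<subseteq> generated R (Suc n) b" "y \<in> generated R (Suc n) b"
      "generated R (Suc n) b \<subseteq> I"
      using generated_insert[of I n a y] submoduleD[OF I] J J_gen by auto
    obtain z where z: "z \<in> J" "z \<noteq> 0"
      using J nonzero_elem by blast
    have "generated R (Suc n) b \<in> ?F"
      using nonzero_fractional_ideal_sandwich[OF submodule_generated _ z(2) b(3) I] z b
      unfolding finitely_generated_def by blast
    \<comment> \<open>By maximality the extra generator \<open>y\<close> does not enlarge the
      closure, so \<open>y\<close> was in \<open>D\<close> already.\<close>
    then have "v_closure R (generated R (Suc n) b) = D"
      using max v_closure_mono[OF b(1)] J(2) by blast
    then show "y \<in> D"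
      using b(2) subset_v_closure by blast
  qed
  then have "v_closure R I \<subseteq> D"
    using v_closure_mono[of I D] J(2) v_closure_idem by simp
  then show "v_closure R I \<subseteq> t_closure R I"
    using J unfolding t_closure_def by blast
qed

section \<open>The \<open>t\<close>-maximal ideals as maximal proper divisorial ideals\<close>

lemma t_ideal_iff_divisorial: "t_ideal R I \<longleftrightarrow> divisorial R I"
  unfolding t_ideal_def divisorial_def using t_closure_eq_v_closure by blast

lemma subset_t_Max:
  assumes "divisorial R D" "integral_ideal R D" "D \<noteq> R"
  obtains M where "M \<in> t_Max R" "D \<subseteq> M"
proof -
  let ?S = "{E. divisorial R E \<and> integral_ideal R E \<and> E \<noteq> R \<and> D \<subseteq> E}"
  have "\<exists>M\<in>?S. \<forall>E\<in>?S. M \<subseteq> E \<longrightarrow> E = M"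
    using assms by (intro divisorial_maximal[of ?S 1]) (auto simp: integral_ideal_def)
  then obtain M where M: "M \<in> ?S" "\<forall>E\<in>?S. M \<subseteq> E \<longrightarrow> E = M"
    by (rule bexE)
  then have "M \<in> t_Max R"
    unfolding t_Max_def proper_integral_t_ideal_def t_ideal_iff_divisorial by blast
  with M show ?thesis
    using that by blast
qed

lemma t_Max_divisorial: "M \<in> t_Max R \<Longrightarrow> divisorial R M"
  and t_Max_integral: "M \<in> t_Max R \<Longrightarrow> integral_ideal R M"
  and t_Max_proper: "M \<in> t_Max R \<Longrightarrow> M \<noteq> R"
  and t_Max_maximal: "M \<in> t_Max R \<Longrightarrow> divisorial R D \<Longrightarrow> integral_ideal R D \<Longrightarrow> D \<noteq> R \<Longrightarrow>
      M \<subseteq> D \<Longrightarrow> D = M"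
  unfolding t_Max_def proper_integral_t_ideal_def t_ideal_iff_divisorial by auto

text \<open>The transporter is a proper divisorial ideal containing \<open>M\<close>, so maximality
  of \<open>M\<close> leaves no choice.\<close>

lemma transporter_eq_t_Max:
  assumes M: "M \<in> t_Max R" and D: "divisorial R D" and z: "z \<notin> D" "\<And>m. m \<in> M \<Longrightarrow> m * z \<in> D"
  shows "transporter D z = M"
proof -
  have D': "submodule R D"
    using D submoduleD unfolding divisorial_def by blast
  have "M \<subseteq> transporter D z"
    using z(2) t_Max_integral[OF M] unfolding transporter_def integral_ideal_def by blast
  then show ?thesis
    using t_Max_maximal[OF M divisorial_transporter[OF D] integral_transporter[OF D']]
      transporter_eq_ring_iff[OF D'] z(1) by blast
qed

lemma t_Max_prime:
  assumes M: "M \<in> t_Max R"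
  shows "prime_ideal R M"
  unfolding prime_ideal_def
proof (intro conjI ballI impI)
  show "integral_ideal R M" "M \<noteq> R"
    using t_Max_integral[OF M] t_Max_proper[OF M] .
  fix x y assume xy: "x \<in> R" "y \<in> R" "x * y \<in> M"
  show "x \<in> M \<or> y \<in> M"
  proof (rule disjCI)
    assume "y \<notin> M"
    \<comment> \<open>As \<open>y\<close> is outside \<open>M\<close> and multiplies
      \<open>M\<close> into \<open>M\<close>, its conductor into \<open>M\<close> is
      \<open>M\<close> itself, and \<open>x\<close> belongs to it.\<close>
    then have "transporter M y = M"
      using t_Max_integral[OF M] xy(2) submodule_mult[of M y]
      by (intro transporter_eq_t_Max[OF M t_Max_divisorial[OF M]])
         (auto simp: integral_ideal_def mult.commute)
    then show "x \<in> M"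
      using xy unfolding transporter_def by blast
  qed
qed

lemma t_Max_submodule: "M \<in> t_Max R \<Longrightarrow> submodule R M"
  using t_Max_integral unfolding integral_ideal_def by blast

lemma t_Max_subset: "M \<in> t_Max R \<Longrightarrow> M \<subseteq> R"
  using t_Max_integral unfolding integral_ideal_def by blast

lemma t_Max_mult_notin: "M \<in> t_Max R \<Longrightarrow> x \<in> R - M \<Longrightarrow> y \<in> R - M \<Longrightarrow> x * y \<in> R - M"
  using t_Max_prime unfolding prime_ideal_def by blast

lemma t_Max_one_notin: "M \<in> t_Max R \<Longrightarrow> 1 \<in> R - M"
  using t_Max_submodule[of M] t_Max_subset[of M] t_Max_proper[of M] submodule_mult[of M _ 1] by auto

section \<open>The \<open>w\<close>-operation through denominators outside the
  \<open>t\<close>-maximal ideals\<close>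

lemma mem_w_closure_iff:
  assumes "submodule R I"
  shows "x \<in> w_closure R I \<longleftrightarrow> (\<forall>M\<in>t_Max R. \<exists>s\<in>R - M. s * x \<in> I)"
  unfolding w_closure_def
  using mem_module_product_localization_iff[OF assms] t_Max_prime by auto

lemma subset_w_closure:
  assumes "submodule R I"
  shows "I \<subseteq> w_closure R I"
  using mem_w_closure_iff[OF assms] t_Max_one_notin by (metis mult_1 subsetI)

lemma w_closure_mono:
  assumes "submodule R I" "submodule R J" "I \<subseteq> J"
  shows "w_closure R I \<subseteq> w_closure R J"
  using assms(3) unfolding subset_iff mem_w_closure_iff[OF assms(1)] mem_w_closure_iff[OF assms(2)]
  by blast

lemma submodule_w_closure:
  assumes I: "submodule R I"
  shows "submodule R (w_closure R I)"
  unfolding submodule_def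
proof (intro conjI ballI)
  show "0 \<in> w_closure R I"
    using subset_w_closure[OF I] submodule_zero[OF I] by blast
next
  fix x y assume xy: "x \<in> w_closure R I" "y \<in> w_closure R I"
  show "x + y \<in> w_closure R I"
    unfolding mem_w_closure_iff[OF I]
  proof
    fix M assume M: "M \<in> t_Max R"
    obtain s t where st: "s \<in> R - M" "s * x \<in> I" "t \<in> R - M" "t * y \<in> I"
      using xy M unfolding mem_w_closure_iff[OF I] by blast
    have "(s * t) * (x + y) = t * (s * x) + s * (t * y)"
      by (simp add: algebra_simps)
    also have "\<dots> \<in> I"
      using st submodule_add[OF I] submodule_mult[OF I] by simp
    finally show "\<exists>s\<in>R - M. s * (x + y) \<in> I"
      using t_Max_mult_notin[OF M st(1,3)] by blast
  qed
next
  fix r x assume "r \<in> R" "x \<in> w_closure R I"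
  then show "r * x \<in> w_closure R I"
    unfolding mem_w_closure_iff[OF I] using submodule_mult[OF I] by (metis mult.left_commute)
qed

lemma w_closure_idem:
  assumes I: "submodule R I"
  shows "w_closure R (w_closure R I) = w_closure R I"
proof
  show "w_closure R (w_closure R I) \<subseteq> w_closure R I"
  proof
    fix x assume x: "x \<in> w_closure R (w_closure R I)"
    show "x \<in> w_closure R I"
      unfolding mem_w_closure_iff[OF I]
    proof
      fix M assume M: "M \<in> t_Max R"
      obtain s where s: "s \<in> R - M" "s * x \<in> w_closure R I"
        using x M unfolding mem_w_closure_iff[OF submodule_w_closure[OF I]] by blast
      then obtain t where t: "t \<in> R - M" "t * (s * x) \<in> I"
        using M unfolding mem_w_closure_iff[OF I] by blast
      then show "\<exists>s\<in>R - M. s * x \<in> I"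
        using t_Max_mult_notin[OF M t(1) s(1)] by (metis mult.assoc)
    qed
  qed
qed (rule subset_w_closure[OF submodule_w_closure[OF I]])

text \<open>If \<open>z\<close> were outside \<open>D\<close>, its conductor would lie in some
  \<open>t\<close>-maximal ideal \<open>M\<close>, and no denominator outside \<open>M\<close> could
  exist.\<close>

lemma mem_divisorial_locally:
  assumes D: "divisorial R D" and z: "\<And>M. M \<in> t_Max R \<Longrightarrow> \<exists>s\<in>R - M. s * z \<in> D"
  shows "z \<in> D"
proof (rule ccontr)
  assume "z \<notin> D"
  have "submodule R D"
    using D submoduleD unfolding divisorial_def by blast
  then have "integral_ideal R (transporter D z)" "transporter D z \<noteq> R"
    using integral_transporter transporter_eq_ring_iff \<open>z \<notin> D\<close> by blast+
  then obtain M where "M \<in> t_Max R" "transporter D z \<subseteq> M"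
    using subset_t_Max divisorial_transporter[OF D] by blast
  then show False
    using z unfolding transporter_def by blast
qed

lemma w_closure_subset_divisorial:
  assumes "submodule R I" "divisorial R D" "I \<subseteq> D"
  shows "w_closure R I \<subseteq> D"
proof
  fix z assume "z \<in> w_closure R I"
  then have "\<exists>s\<in>R - M. s * z \<in> D" if "M \<in> t_Max R" for M
    using that assms(3) unfolding mem_w_closure_iff[OF assms(1)] by blast
  then show "z \<in> D"
    by (rule mem_divisorial_locally[OF assms(2)])
qed

lemma w_closure_subset_v_closure:
  assumes "nonzero_fractional_ideal R I"
  shows "w_closure R I \<subseteq> v_closure R I"
  using w_closure_subset_divisorial[OF submoduleD[OF assms] divisorial_v_closure[OF assms]
      subset_v_closure] .

text \<open>The \<open>w\<close>-closure of \<open>I\<close> is a \<open>w\<close>-ideal, hence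
  divisorial, and a divisorial ideal containing \<open>I\<close> contains its
  \<open>v\<close>-closure.\<close>

lemma w_divisorial_domain_imp_w_divisorial:
  assumes "w_divisorial_domain R" and I: "nonzero_fractional_ideal R I"
  shows "w_divisorial R I"
proof -
  have sub: "I \<subseteq> w_closure R I" "w_closure R I \<subseteq> v_closure R I"
    using subset_w_closure[OF submoduleD[OF I]] w_closure_subset_v_closure[OF I] by auto
  obtain x where "x \<in> I" "x \<noteq> 0"
    using nonzero_elem I .
  then have "nonzero_fractional_ideal R (w_closure R I)"
    using nonzero_fractional_ideal_sandwich[OF submodule_w_closure[OF submoduleD[OF I]] _ _ sub(2)]
      sub(1) divisorial_v_closure[OF I] unfolding divisorial_def by blast
  then have "w_ideal R (w_closure R I)"
    unfolding w_ideal_def using w_closure_idem[OF submoduleD[OF I]] by simp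
  then have "w_closure R I = v_closure R (w_closure R I)"
    using assms(1) unfolding w_divisorial_domain_def divisorial_def by blast
  then have "v_closure R I \<subseteq> w_closure R I"
    using v_closure_mono[OF sub(1)] by simp
  then show ?thesis
    unfolding w_divisorial_def using I sub(2) by blast
qed

section \<open>From condition (2) to condition (3)\<close>

lemma t_Max_colon_not_subset:
  assumes M: "M \<in> t_Max R"
  obtains y where "y \<in> colon R M" "y \<notin> R"
proof -
  \<comment> \<open>Otherwise \<open>1\<close> would lie in the \<open>v\<close>-closure of
    \<open>M\<close>, which is \<open>M\<close>.\<close>
  have "\<not> colon R M \<subseteq> R"
  proof
    assume "colon R M \<subseteq> R"
    then have "1 \<in> v_closure R M"
      unfolding v_closure_def colon_def by auto
    then show False
      using t_Max_divisorial[OF M] t_Max_one_notin[OF M] unfolding divisorial_def by blast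
  qed
  then show ?thesis
    using that by blast
qed

lemma t_prime_height_one:
  assumes vw: "\<And>x y. x \<in> R \<Longrightarrow> y \<in> R \<Longrightarrow> x \<noteq> 0 \<Longrightarrow>
      v_closure R (pair_ideal x y) = w_closure R (pair_ideal x y)"
    and P: "t_prime R P"
  shows "height R P = 1"
proof (rule antisym)
  have prime: "prime_ideal R P" and div: "divisorial R P"
    using P unfolding t_prime_def t_ideal_iff_divisorial by auto
  have "P \<noteq> {0}"
    using div unfolding divisorial_def nonzero_fractional_ideal_def by auto
  then show "1 \<le> height R P"
    using height_ge_1 prime by blast
  have "integral_ideal R P" "P \<noteq> R"
    using prime unfolding prime_ideal_def by auto
  then obtain M where M: "M \<in> t_Max R" "P \<subseteq> M"
    using subset_t_Max[OF div] by blast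
  show "height R P \<le> 1"
  proof (rule height_le_1, rule ccontr)
    fix Q assume Q: "prime_ideal R Q" "Q \<subset> P" "Q \<noteq> {0}"
    have subQ: "submodule R Q" "Q \<subseteq> R"
      using Q(1) unfolding prime_ideal_def integral_ideal_def by auto
    obtain x where x: "x \<in> Q" "x \<noteq> 0"
      using Q(3) submodule_zero[OF subQ(1)] by blast
    obtain a where a: "a \<in> P" "a \<notin> Q"
      using Q(2) by blast
    have xR: "x \<in> R" and aM: "a \<in> M" and aR: "a \<in> R"
      using x subQ a M t_Max_subset by auto
    define J where "J = (\<lambda>n. pair_ideal x (a ^ n))"
    have J_sub: "J n \<subseteq> R" for n
      unfolding J_def pair_ideal_def using xR aR by auto
    have xJ: "x \<in> J n" for n
      unfolding J_def by (rule pair_ideal_left)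
    have nfJ: "nonzero_fractional_ideal R (J n)" for n
      using nonzero_fractional_ideal_sandwich[OF _ xJ x(2) J_sub nonzero_fractional_ideal_ring]
        submodule_pair unfolding J_def by blast
    \<comment> \<open>The divisorial ideals \<open>x (R : J n)\<close> of \<open>R\<close> increase, so the descending chain of the
      divisorial closures of the \<open>J n\<close> becomes stationary.\<close>
    have "\<exists>D\<in>range (\<lambda>n. colon R (J n)). \<forall>E\<in>range (\<lambda>n. colon R (J n)). D \<subseteq> E \<longrightarrow> E = D"
    proof (rule divisorial_maximal[OF _ _ x(2)])
      show "range (\<lambda>n. colon R (J n)) \<noteq> {}"
        by simp
      show "divisorial R D" if "D \<in> range (\<lambda>n. colon R (J n))" for D
        using that divisorial_colon[OF nfJ] by auto
      show "x * f \<in> R" if "D \<in> range (\<lambda>n. colon R (J n))" "f \<in> D" for D f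
        using that xJ unfolding colon_def by (auto simp: mult.commute)
    qed
    then obtain n where n: "\<And>m. colon R (J n) \<subseteq> colon R (J m) \<Longrightarrow> colon R (J m) = colon R (J n)"
      by auto
    have "J (Suc n) \<subseteq> J n"
    proof
      fix z assume "z \<in> J (Suc n)"
      then obtain r s where "r \<in> R" "s \<in> R" "z = r * x + s * a ^ Suc n"
        unfolding J_def pair_ideal_def by blast
      then show "z \<in> J n"
        using pair_idealI[of r "s * a" x "a ^ n"] aR unfolding J_def
        by (simp add: mult.assoc mult_mem)
    qed
    then have "colon R (J (Suc n)) = colon R (J n)"
      using n colon_antimono by blast
    moreover have "a ^ n \<in> v_closure R (J n)"
      using subset_v_closure pair_ideal_right unfolding J_def by blast
    ultimately have "a ^ n \<in> v_closure R (J (Suc n))"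
      unfolding v_closure_def by simp
    \<comment> \<open>Here the hypothesis turns a divisorial relation into one that holds locally at
      \<open>M\<close>.\<close>
    then have "a ^ n \<in> w_closure R (J (Suc n))"
      using vw[OF xR power_mem[OF aR] x(2)] unfolding J_def by blast
    then obtain s where s: "s \<in> R - M" "s * a ^ n \<in> J (Suc n)"
      using M(1) mem_w_closure_iff[OF submoduleD[OF nfJ]] by blast
    then obtain r t where rt: "r \<in> R" "t \<in> R" "s * a ^ n = r * x + t * a ^ Suc n"
      unfolding J_def pair_ideal_def by blast
    \<comment> \<open>Since \<open>a\<close> is in \<open>M\<close> and \<open>s\<close> is not,
      \<open>s - t * a\<close> is a unit at \<open>M\<close>; it therefore avoids \<open>Q\<close>,
      so \<open>Q\<close> would have to contain a power of \<open>a\<close>.\<close>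
    have "(s - t * a) * a ^ n = r * x"
      using rt(3) by (simp add: algebra_simps)
    then have "(s - t * a) * a ^ n \<in> Q"
      using submodule_mult[OF subQ(1) rt(1) x(1)] by simp
    moreover have "s - t * a \<in> R"
      using s rt aR by auto
    moreover have "s - t * a \<notin> M"
    proof
      assume "s - t * a \<in> M"
      then have "(s - t * a) + t * a \<in> M"
        using submodule_add submodule_mult t_Max_submodule[OF M(1)] rt(2) aM by blast
      then show False
        using s by simp
    qed
    moreover have "a ^ k \<notin> Q" for k
    proof (induction k)
      case 0
      then show ?case
        using Q(2) M t_Max_one_notin[OF M(1)] by auto
    next
      case (Suc k)
      then show ?case
        using Q(1) a aR power_mem[OF aR, of k] unfolding prime_ideal_def by auto
    qed
    ultimately show False
      using Q(1,2) M(2) power_mem[OF aR] unfolding prime_ideal_def by blast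
  qed
qed

lemma w_generated_2_colon_t_Max:
  assumes vw: "\<And>x y. x \<in> R \<Longrightarrow> y \<in> R \<Longrightarrow> x \<noteq> 0 \<Longrightarrow>
      v_closure R (pair_ideal x y) = w_closure R (pair_ideal x y)"
    and M: "M \<in> t_Max R"
  shows "w_generated R 2 (colon R M)"
proof -
  have nfM: "nonzero_fractional_ideal R M"
    using t_Max_divisorial[OF M] unfolding divisorial_def by blast
  note divM = divisorial_colon[OF nfM]
  obtain y where y: "y \<in> colon R M" "y \<notin> R"
    using t_Max_colon_not_subset M .
  obtain q where q: "q \<in> R" "q \<noteq> 0" "q * y \<in> R"
    using denominator_obtain .
  \<comment> \<open>The hypothesis concerns ideals inside \<open>R\<close>, so the fractional ideal
    \<open>(1, y)\<close> is scaled by the denominator \<open>q\<close> of \<open>y\<close>.\<close>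
  let ?J = "pair_ideal 1 y" and ?J' = "pair_ideal q (q * y)"
  have scale: "q * z \<in> ?J' \<longleftrightarrow> z \<in> ?J" for z
  proof -
    have "q * z = r * q + s * (q * y) \<longleftrightarrow> z = r * 1 + s * y" for r s
      using q(2) by (metis (no_types, opaque_lifting) distrib_left mult.left_commute mult.right_neutral
          mult_left_cancel)
    then show ?thesis
      unfolding pair_ideal_def by simp
  qed
  have v_sub_w: "v_closure R ?J \<subseteq> w_closure R ?J"
  proof
    fix z assume z: "z \<in> v_closure R ?J"
    have "q * z \<in> v_closure R ?J'"
      unfolding v_closure_def colon_def[of R "colon R ?J'"]
    proof safe
      fix f assume f: "f \<in> colon R ?J'"
      have "f * q \<in> colon R ?J"
        unfolding colon_def
      proof safe
        fix w assume "w \<in> ?J"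
        then have "f * (q * w) \<in> R"
          using f scale unfolding colon_def by blast
        then show "f * q * w \<in> R"
          by (simp add: mult.assoc)
      qed
      then have "z * (f * q) \<in> R"
        using z unfolding v_closure_def colon_def by blast
      then show "q * z * f \<in> R"
        by (simp add: ac_simps)
    qed
    then have "q * z \<in> w_closure R ?J'"
      using vw[OF q(1,3,2)] by simp
    then show "z \<in> w_closure R ?J"
      unfolding mem_w_closure_iff[OF submodule_pair] using scale by (metis mult.left_commute)
  qed
  \<comment> \<open>Multipliers of \<open>1\<close> and \<open>y\<close> into \<open>R\<close> form
    the conductor of \<open>y\<close> into \<open>R\<close>, and this equals
    \<open>M\<close>.\<close>
  have "colon R ?J = M"
  proof
    show "colon R ?J \<subseteq> M"
    proof
      fix f assume f: "f \<in> colon R ?J"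
      have "f * 1 \<in> R" "f * y \<in> R"
        using f pair_ideal_left[of 1 y] pair_ideal_right[of y 1] unfolding colon_def by blast+
      moreover have "transporter R y = M"
        using y by (intro transporter_eq_t_Max[OF M divisorial_ring])
          (auto simp: colon_def mult.commute)
      ultimately show "f \<in> M"
        unfolding transporter_def by auto
    qed
    show "M \<subseteq> colon R ?J"
    proof
      fix m assume m: "m \<in> M"
      have "m \<in> R" "m * y \<in> R"
        using m y(1) t_Max_subset[OF M] unfolding colon_def by (auto simp: mult.commute)
      then have "m * (r * 1 + s * y) \<in> R" if "r \<in> R" "s \<in> R" for r s
        using that add_mem[OF mult_mem[of r m] mult_mem[of s "m * y"]] by (simp add: algebra_simps)
      then show "m \<in> colon R ?J"
        unfolding colon_def pair_ideal_def by blast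
    qed
  qed
  then have vJ: "v_closure R ?J = colon R M"
    unfolding v_closure_def by simp
  have "w_closure R (colon R M) = colon R M"
    using w_closure_subset_divisorial[OF _ divM] subset_w_closure
      submodule_colon[OF submodule_ring] by blast
  moreover have "w_closure R ?J = colon R M"
    using w_closure_subset_divisorial[OF submodule_pair divM] v_sub_w vJ subset_v_closure by blast
  ultimately show ?thesis
    unfolding w_generated_def using divM pair_ideal_generated[of 1 y]
    unfolding divisorial_def by metis
qed

section \<open>From condition (3) to condition (1)\<close>

lemma mem_divisorial_t_Max:
  assumes "M \<in> t_Max R" "divisorial R D" "\<And>m. m \<in> M \<Longrightarrow> m * z \<in> D" "u \<in> R - M" "u * z \<in> D"
  shows "z \<in> D"
  using transporter_eq_t_Max[OF assms(1,2) _ assms(3)] assms(4,5) unfolding transporter_def by blast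

text \<open>Locally at \<open>M\<close> there is no module strictly between \<open>R\<close> and \<open>(R : M)\<close>: either \<open>M\<close> is
  locally principal, or \<open>(R : M) / M\<close> is locally a vector space of dimension at most two over
  the residue field.\<close>

lemma colon_t_Max_simple:
  assumes M: "M \<in> t_Max R" and gen: "w_generated R 2 (colon R M)"
    and y: "y \<in> colon R M" "y \<notin> R" and z: "z \<in> colon R M"
  shows "\<exists>u\<in>R - M. \<exists>r\<in>R. \<exists>s\<in>R. u * z = r + s * y"
proof -
  have MR: "t * m \<in> R" "m * t \<in> R" if "t \<in> colon R M" "m \<in> M" for t m
    using that unfolding colon_def by (auto simp: mult.commute)
  \<comment> \<open>The conductor of \<open>y\<close> into \<open>R\<close> is exactly
    \<open>M\<close>, so no element outside \<open>M\<close> can bring \<open>y\<close> into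
    \<open>R\<close>.\<close>
  have y_trick: False if "u \<in> R - M" "u * y \<in> R" for u
    using mem_divisorial_t_Max[OF M divisorial_ring _ that] MR(2)[OF y(1)] y(2) by blast
  show ?thesis
  proof (cases "\<forall>t\<in>colon R M. \<forall>m\<in>M. t * m \<in> M")
    case False
    then obtain t m where tm: "t \<in> colon R M" "m \<in> M" "t * m \<in> R - M"
      using MR by blast
    \<comment> \<open>Here \<open>t * m\<close> is a unit at \<open>M\<close>, and by
      \<open>y_trick\<close> so is \<open>m * y\<close>. Hence \<open>y\<close> alone generates
      \<open>(R : M)\<close> locally.\<close>
    have "m * y \<notin> M"
    proof
      assume "m * y \<in> M"
      then have "(t * m) * y \<in> R"
        using MR(1)[OF tm(1)] by (metis mult.assoc)
      then show False
        using y_trick tm(3) by blast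
    qed
    then have "(t * m) * (m * y) \<in> R - M"
      using t_Max_mult_notin[OF M tm(3)] MR(2)[OF y(1) tm(2)] by blast
    moreover have "((t * m) * (m * y)) * z = 0 + ((t * m) * (m * z)) * y"
      by (simp add: ac_simps)
    moreover have "(t * m) * (m * z) \<in> R"
      using tm(3) MR(2)[OF z tm(2)] by blast
    ultimately show ?thesis
      using zero_mem by blast
  next
    \<comment> \<open>Now \<open>(R : M)\<close> multiplies \<open>M\<close> into \<open>M\<close>.
      Locally \<open>a\<close> and \<open>b\<close> generate \<open>(R : M)\<close>, and the
      elements \<open>1\<close>, \<open>y\<close>, \<open>z\<close> are expressed in them.\<close>
    case True
    obtain a0 where "w_closure R (colon R M) = w_closure R (generated R 2 a0)"
      using gen unfolding w_generated_def by blast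
    then obtain a b where ab: "w_closure R (colon R M) = w_closure R (pair_ideal a b)"
      unfolding generated_2 by blast
    have divC: "divisorial R (colon R M)"
      using divisorial_colon t_Max_divisorial[OF M] unfolding divisorial_def by blast
    have subC: "submodule R (colon R M)"
      using submodule_colon submodule_ring by blast
    have "w_closure R (colon R M) = colon R M"
      using w_closure_subset_divisorial[OF subC divC] subset_w_closure[OF subC] by blast
    with ab have C: "colon R M = w_closure R (pair_ideal a b)"
      by simp
    then have a: "a \<in> colon R M" and b: "b \<in> colon R M"
      using subset_w_closure[OF submodule_pair] pair_ideal_left pair_ideal_right by blast+
    have repr: "\<exists>u\<in>R - M. \<exists>r\<in>R. \<exists>s\<in>R. u * w = r * a + s * b"
      if w: "w \<in> colon R M" for w
    proof -
      obtain u where "u \<in> R - M" "u * w \<in> pair_ideal a b"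
        using bspec[OF w[unfolded C mem_w_closure_iff[OF submodule_pair]] M] by (rule bexE)
      moreover from this obtain r s where "r \<in> R" "s \<in> R" "u * w = r * a + s * b"
        unfolding pair_ideal_def by blast
      ultimately show ?thesis
        by blast
    qed
    have "1 \<in> colon R M"
      using t_Max_subset[OF M] unfolding colon_def by auto
    then obtain u1 r1 s1 where 1: "u1 \<in> R - M" "r1 \<in> R" "s1 \<in> R" "u1 = r1 * a + s1 * b"
      using repr[of 1] by auto
    obtain u2 r2 s2 where 2: "u2 \<in> R - M" "r2 \<in> R" "s2 \<in> R" "u2 * y = r2 * a + s2 * b"
      using repr[OF y(1)] by blast
    obtain u3 r3 s3 where 3: "u3 \<in> R - M" "r3 \<in> R" "s3 \<in> R" "u3 * z = r3 * a + s3 * b"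
      using repr[OF z] by blast
    \<comment> \<open>This is the determinant of the coordinates of \<open>1\<close> and
      \<open>y\<close>, up to units at \<open>M\<close>; \<open>da\<close> and \<open>db\<close> are
      Cramer's rule.\<close>
    define \<delta> where "\<delta> = r1 * s2 - s1 * r2"
    have \<delta>R: "\<delta> \<in> R"
      unfolding \<delta>_def using 1 2 by auto
    have da: "a * \<delta> = s2 * u1 - s1 * (u2 * y)" and db: "b * \<delta> = r1 * (u2 * y) - r2 * u1"
      unfolding \<delta>_def 2(4) 1(4) by (simp_all add: algebra_simps)
    show ?thesis
    proof (cases "\<delta> \<in> M")
      \<comment> \<open>A determinant in \<open>M\<close> makes \<open>s1 * u2\<close> and
        \<open>r1 * u2\<close> carry \<open>y\<close> into \<open>R\<close>. Since \<open>u1\<close>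
        is outside \<open>M\<close>, one of \<open>r1\<close>, \<open>s1\<close> is too,
        contradicting \<open>y_trick\<close>.\<close>
      case \<delta>M: True
      have "s1 * u2 * y = s2 * u1 - a * \<delta>" "r1 * u2 * y = r2 * u1 + b * \<delta>"
        unfolding da db by (simp_all add: algebra_simps)
      then have *: "s1 * u2 * y \<in> R" "r1 * u2 * y \<in> R"
        using 1 2 MR(1)[OF a \<delta>M] MR(1)[OF b \<delta>M] by auto
      have "s1 \<notin> M \<or> r1 \<notin> M"
      proof (rule ccontr)
        assume "\<not> ?thesis"
        then have "a * r1 + b * s1 \<in> M"
          using True a b submodule_add[OF t_Max_submodule[OF M]] by blast
        then show False
          using 1(1,4) by (simp add: mult.commute)
      qed
      then have "s1 * u2 \<in> R - M \<or> r1 * u2 \<in> R - M"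
        using t_Max_mult_notin[OF M] 1 2 by blast
      then show ?thesis
        using y_trick * by blast
    next
      \<comment> \<open>The determinant is a unit at \<open>M\<close>, so \<open>1\<close> and
        \<open>y\<close> generate \<open>(R : M)\<close> locally.\<close>
      case False
      then have "\<delta> * u3 \<in> R - M"
        using t_Max_mult_notin[OF M] 3 \<delta>R by blast
      moreover have "(\<delta> * u3) * z = r3 * (a * \<delta>) + s3 * (b * \<delta>)"
        unfolding mult.assoc[of \<delta>] 3(4) by (simp add: algebra_simps)
      then have "(\<delta> * u3) * z = (r3 * s2 * u1 - s3 * r2 * u1) + (s3 * r1 * u2 - r3 * s1 * u2) * y"
        unfolding da db by (simp add: algebra_simps)
      moreover have "r3 * s2 * u1 - s3 * r2 * u1 \<in> R" "s3 * r1 * u2 - r3 * s1 * u2 \<in> R"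
        using 1 2 3 by auto
      ultimately show ?thesis
        by blast
    qed
  qed
qed

text \<open>With \<open>B = (R : D)\<close> and \<open>E = D + b R\<close>, multiplication by \<open>b\<close> embeds \<open>B / (R : E)\<close> into
  \<open>(R : M) / R\<close>, and multiplication by any \<open>c \<in> B\<close> with \<open>c b \<notin> R\<close> embeds \<open>E\<^sub>v / D\<close> into
  \<open>(R : M) / R\<close> locally at \<open>M\<close>. As the target is simple there, so is \<open>E\<^sub>v / D\<close>, and \<open>E\<^sub>v = E\<close>
  locally.\<close>

lemma v_closure_adjoin_subset:
  assumes M: "M \<in> t_Max R" and gen: "w_generated R 2 (colon R M)"
    and D: "divisorial R D" and b: "b \<notin> D" "\<And>m. m \<in> M \<Longrightarrow> m * b \<in> D"
  shows "v_closure R (adjoin D b) \<subseteq> w_closure R (adjoin D b)"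
proof
  let ?E = "adjoin D b" and ?B = "colon R D"
  have nfD: "nonzero_fractional_ideal R D" and vD: "D = v_closure R D"
    using D unfolding divisorial_def by auto
  note sD = submoduleD[OF nfD]
  have memD: "w \<in> D \<longleftrightarrow> (\<forall>f\<in>?B. w * f \<in> R)" for w
    by (subst vD) (simp add: v_closure_def colon_def[of R "colon R D"])
  have memB: "f * d \<in> R" if "f \<in> ?B" "d \<in> D" for f d
    using that unfolding colon_def by blast
  have MR: "m \<in> R" if "m \<in> M" for m
    using that t_Max_subset[OF M] by blast
  have ME: "m * g \<in> D" if g: "g \<in> v_closure R ?E" and m: "m \<in> M" for g m
    unfolding memD
  proof
    fix f assume f: "f \<in> ?B"
    have "m * f \<in> colon R ?E"
      unfolding colon_def adjoin_def
    proof clarify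
      fix d r assume "d \<in> D" "r \<in> R"
      have "m * f * (d + r * b) = m * (f * d) + r * (f * (m * b))"
        by (simp add: algebra_simps)
      also have "\<dots> \<in> R"
        using memB[OF f] b(2)[OF m] MR[OF m] \<open>d \<in> D\<close> \<open>r \<in> R\<close> by blast
      finally show "m * f * (d + r * b) \<in> R" .
    qed
    then have "g * (m * f) \<in> R"
      using g unfolding v_closure_def colon_def by blast
    then show "m * g * f \<in> R"
      by (simp add: ac_simps)
  qed
  \<comment> \<open>These products lie in \<open>(R : M)\<close>, so
    \<open>colon_t_Max_simple\<close> can compare them with \<open>c * b\<close>.\<close>
  have colonM: "f * g \<in> colon R M" if "f \<in> ?B" "g \<in> v_closure R ?E" for f g
    unfolding colon_def
  proof safe
    fix m assume "m \<in> M"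
    then have "f * (m * g) \<in> R"
      using ME memB that by blast
    then show "f * g * m \<in> R"
      by (simp add: ac_simps)
  qed
  have bE: "b \<in> v_closure R ?E"
    using adjoin_mem[OF sD] subset_v_closure by blast
  \<comment> \<open>Such a multiplier detects that \<open>b\<close> is outside the divisorial ideal
    \<open>D\<close>.\<close>
  obtain c where c: "c \<in> ?B" "c * b \<notin> R"
    using b(1) unfolding memD[of b] by (auto simp: mult.commute)
  fix g assume g: "g \<in> v_closure R ?E"
  show "g \<in> w_closure R ?E"
    unfolding mem_w_closure_iff[OF submodule_adjoin[OF sD]]
  proof
    fix N assume N: "N \<in> t_Max R"
    show "\<exists>s\<in>R - N. s * g \<in> ?E"
    proof (cases "N = M")
      case False
      \<comment> \<open>At the other \<open>t\<close>-maximal ideals an element of \<open>M\<close>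
        outside \<open>N\<close> already sends \<open>g\<close> into \<open>D\<close>.\<close>
      then have "\<not> M \<subseteq> N"
        using t_Max_maximal[OF M] t_Max_divisorial[OF N] t_Max_integral[OF N] t_Max_proper[OF N]
        by blast
      then obtain s where "s \<in> M" "s \<notin> N"
        by blast
      then show ?thesis
        using ME[OF g] MR subset_adjoin by blast
    next
      case True
      obtain u r s where urs: "u \<in> R - M" "r \<in> R" "s \<in> R" "u * (c * g) = r + s * (c * b)"
        using colon_t_Max_simple[OF M gen colonM[OF c(1) bE] c(2) colonM[OF c(1) g]] by blast
      \<comment> \<open>The multiple of \<open>b\<close> is chosen so that \<open>c\<close> carries
        \<open>h\<close> into \<open>R\<close>; it remains to see that every multiplier of
        \<open>D\<close> does.\<close>
      define h where "h = u * g - s * b"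
      have hE: "h \<in> v_closure R ?E"
        unfolding h_def using urs g bE submodule_v_closure submodule_diff submodule_mult by blast
      have hc: "h * c = r"
        using urs(4) unfolding h_def by (simp add: algebra_simps)
      have "h \<in> D"
        unfolding memD
      proof
        fix f assume f: "f \<in> ?B"
        obtain u' r' s' where *: "u' \<in> R - M" "r' \<in> R" "s' \<in> R" "u' * (f * b) = r' + s' * (c * b)"
          using colon_t_Max_simple[OF M gen colonM[OF c(1) bE] c(2) colonM[OF f bE]] by blast
        \<comment> \<open>Up to the unit \<open>u'\<close> at \<open>M\<close>, \<open>f\<close>
          differs from a multiple of \<open>c\<close> by a multiplier of the enlarged ideal. Both
          parts carry \<open>h\<close> into \<open>R\<close>.\<close>
        have "u' * f - s' * c \<in> colon R ?E"
          unfolding colon_def adjoin_def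
        proof clarify
          fix d t assume "d \<in> D" "t \<in> R"
          have "(u' * f - s' * c) * (d + t * b)
              = u' * (f * d) - s' * (c * d) + t * (u' * (f * b) - s' * (c * b))"
            by (simp add: algebra_simps)
          also have "\<dots> = u' * (f * d) - s' * (c * d) + t * r'"
            using *(4) by simp
          also have "\<dots> \<in> R"
            using memB[OF f \<open>d \<in> D\<close>] memB[OF c(1) \<open>d \<in> D\<close>] * \<open>t \<in> R\<close> by blast
          finally show "(u' * f - s' * c) * (d + t * b) \<in> R" .
        qed
        then have "h * (u' * f - s' * c) \<in> R"
          using hE unfolding v_closure_def colon_def by blast
        then have "h * (u' * f - s' * c) + s' * r \<in> R"
          using * urs by blast
        then have "u' * (h * f) \<in> R"
          unfolding hc[symmetric] by (simp add: algebra_simps)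
        moreover have "m * (h * f) \<in> R" if "m \<in> M" for m
          using colonM[OF f hE] that unfolding colon_def by (auto simp: ac_simps)
        ultimately show "h * f \<in> R"
          using mem_divisorial_t_Max[OF M divisorial_ring _ *(1)] by blast
      qed
      then have "u * g \<in> ?E"
        using adjoinI[of h D s b] urs(3) unfolding h_def by simp
      then show ?thesis
        using urs(1) True by blast
    qed
  qed
qed

lemma w_divisorial_domainI:
  assumes dim: "t_dimension_one R" and gen: "\<And>M. M \<in> t_Max R \<Longrightarrow> w_generated R 2 (colon R M)"
  shows "w_divisorial_domain R"
  unfolding w_divisorial_domain_def
proof (intro allI impI)
  fix I assume I: "w_ideal R I"
  have nfI: "nonzero_fractional_ideal R I" and wI: "I = w_closure R I"
    using I unfolding w_ideal_def by auto
  note sI = submoduleD[OF nfI]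
  obtain x where x: "x \<in> I" "x \<noteq> 0"
    using nonzero_elem nfI .
  obtain e where e: "e \<noteq> 0" "\<forall>x\<in>I. e * x \<in> R"
    using nfI unfolding nonzero_fractional_ideal_def fractional_ideal_def by blast
  let ?S = "{D. divisorial R D \<and> D \<subseteq> I}"
  have "(*) x ` R \<subseteq> I"
    using x(1) submodule_mult[OF sI] by (auto simp: mult.commute)
  then have "(*) x ` R \<in> ?S"
    using divisorial_scale[OF divisorial_ring x(2)] by blast
  then have "\<exists>D\<in>?S. \<forall>E\<in>?S. D \<subseteq> E \<longrightarrow> E = D"
    using e by (intro divisorial_maximal[of ?S e]) auto
  then obtain D where D: "D \<in> ?S" "\<forall>E\<in>?S. D \<subseteq> E \<longrightarrow> E = D"
    by (rule bexE)
  then have divD: "divisorial R D" and DI: "D \<subseteq> I"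
    by auto
  then have nfD: "nonzero_fractional_ideal R D"
    unfolding divisorial_def by blast
  note sD = submoduleD[OF nfD]
  have "I \<subseteq> D"
  proof (rule ccontr)
    assume "\<not> I \<subseteq> D"
    then obtain b0 where b0: "b0 \<in> I" "b0 \<notin> D"
      by blast
    \<comment> \<open>Only multiples of \<open>b0\<close> are used, which keeps them in
      \<open>I\<close>. The family is stable under further multiplication by \<open>R\<close>
      outside \<open>D\<close>, and this makes a maximal conductor prime.\<close>
    let ?T = "{transporter D (p * b0) | p. p \<in> R \<and> p * b0 \<notin> D}"
    have "transporter D (1 * b0) \<in> ?T"
      using b0(2) one_mem by (intro CollectI exI[of _ 1]) simp
    then have "\<exists>Q\<in>?T. \<forall>Q'\<in>?T. Q \<subseteq> Q' \<longrightarrow> Q' = Q"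
      using divisorial_transporter[OF divD]
      by (intro divisorial_maximal[of ?T 1]) (auto simp: transporter_def)
    then obtain Q where Q: "Q \<in> ?T" "\<forall>Q'\<in>?T. Q \<subseteq> Q' \<longrightarrow> Q' = Q"
      by (rule bexE)
    then obtain p where p: "p \<in> R" "p * b0 \<notin> D" "Q = transporter D (p * b0)"
      by blast
    define b where "b = p * b0"
    have b: "b \<in> I" "b \<notin> D" "Q = transporter D b"
      using p b0 submodule_mult[OF sI] unfolding b_def by auto
    have intQ: "integral_ideal R Q" and neQ: "Q \<noteq> R" and divQ: "divisorial R Q"
      using integral_transporter[OF sD] transporter_eq_ring_iff[OF sD]
        divisorial_transporter[OF divD] b by auto
    have "prime_ideal R Q"
      unfolding prime_ideal_def
    proof (intro conjI ballI impI intQ neQ)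
      fix r s assume rs: "r \<in> R" "s \<in> R" "r * s \<in> Q"
      show "r \<in> Q \<or> s \<in> Q"
      proof (rule disjCI)
        assume "s \<notin> Q"
        then have "s * b \<notin> D"
          using rs(2) unfolding b(3) transporter_def by blast
        then have "transporter D (s * b) \<in> ?T"
          using rs(2) p(1) mult_mem unfolding b_def
          by (intro CollectI exI[of _ "s * p"]) (simp add: mult.assoc)
        moreover have "Q \<subseteq> transporter D (s * b)"
          using submodule_mult[OF sD rs(2)] unfolding b(3) transporter_def
          by (auto simp: mult.left_commute[of _ s])
        ultimately have "transporter D (s * b) = Q"
          using Q(2) by blast
        moreover have "r \<in> transporter D (s * b)"
          using rs unfolding b(3) transporter_def by (auto simp: mult.assoc)
        ultimately show "r \<in> Q"
          by simp
      qed
    qed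
    obtain M where M: "M \<in> t_Max R" "Q \<subseteq> M"
      using subset_t_Max[OF divQ intQ neQ] .
    have "t_prime R M"
      unfolding t_prime_def t_ideal_iff_divisorial
      using t_Max_prime[OF M(1)] t_Max_divisorial[OF M(1)] by blast
    then have "height R M = 1"
      using dim unfolding t_dimension_one_def by blast
    moreover have "Q \<noteq> {0}"
      using divQ unfolding divisorial_def nonzero_fractional_ideal_def by blast
    \<comment> \<open>Height one leaves no room for a nonzero prime strictly below
      \<open>M\<close>.\<close>
    ultimately have "Q = M"
      using height_one_minimal[OF _ t_Max_prime[OF M(1)] \<open>prime_ideal R Q\<close>] M(2) by blast
    then have Mb: "m * b \<in> D" if "m \<in> M" for m
      using that b(3) unfolding transporter_def by blast
    let ?E = "adjoin D b"
    have EI: "?E \<subseteq> I"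
      using DI b(1) submodule_add[OF sI] submodule_mult[OF sI] unfolding adjoin_def by blast
    obtain z where z: "z \<in> D" "z \<noteq> 0"
      using nonzero_elem nfD .
    have "nonzero_fractional_ideal R ?E"
      using nonzero_fractional_ideal_sandwich[OF submodule_adjoin[OF sD] _ z(2) EI nfI]
        z(1) subset_adjoin by blast
    then have "divisorial R (v_closure R ?E)"
      by (rule divisorial_v_closure)
    \<comment> \<open>The \<open>w\<close>-closure of \<open>?E\<close> stays in the
      \<open>w\<close>-ideal \<open>I\<close>, which gives a divisorial ideal inside
      \<open>I\<close> strictly above \<open>D\<close>.\<close>
    moreover have "v_closure R ?E \<subseteq> I"
      using v_closure_adjoin_subset[OF M(1) gen[OF M(1)] divD b(2) Mb]
        w_closure_mono[OF submodule_adjoin[OF sD] sI EI] wI by blast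
    moreover have "D \<subseteq> v_closure R ?E" "b \<in> v_closure R ?E"
      using subset_v_closure[of ?E] subset_adjoin[of D b] adjoin_mem[OF sD] by auto
    ultimately show False
      using D(2) b(2) by blast
  qed
  then show "divisorial R I"
    using divD DI by simp
qed

end

theorem theorem4p2:
  fixes R :: "'k::field set"
  assumes "Mori_domain R" and "R \<noteq> UNIV"
  shows "(w_divisorial_domain R \<longleftrightarrow>
            (\<forall>I. integral_ideal R I \<and> I \<noteq> {0} \<and> two_generated R I \<longrightarrow> w_divisorial R I)) \<and>
         (w_divisorial_domain R \<longleftrightarrow>
            t_dimension_one R \<and> (\<forall>M\<in>t_Max R. w_generated R 2 (colon R M)))"
proof -
  interpret mori_domain R
    using assms(1) by unfold_locales (auto simp: Mori_domain_def)
  let ?two = "\<forall>I. integral_ideal R I \<and> I \<noteq> {0} \<and> two_generated R I \<longrightarrow> w_divisorial R I"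
  let ?dim = "t_dimension_one R \<and> (\<forall>M\<in>t_Max R. w_generated R 2 (colon R M))"
  have "?two" if "w_divisorial_domain R"
  proof (intro allI impI, elim conjE)
    fix I assume "integral_ideal R I" "I \<noteq> {0}"
    then have "nonzero_fractional_ideal R I"
      using submodule_zero nonzero_fractional_ideal_integral unfolding integral_ideal_def by blast
    then show "w_divisorial R I"
      using w_divisorial_domain_imp_w_divisorial that by blast
  qed
  moreover have "?dim" if two: "?two"
  proof -
    \<comment> \<open>A nonzero first generator makes the pair a nonzero ideal, so condition (2)
      applies to it.\<close>
    have "v_closure R (pair_ideal x y) = w_closure R (pair_ideal x y)"
      if "x \<in> R" "y \<in> R" "x \<noteq> 0" for x y
    proof -
      have "pair_ideal x y \<subseteq> R"
        using that unfolding pair_ideal_def by blast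
      then have "integral_ideal R (pair_ideal x y)"
        unfolding integral_ideal_def using submodule_pair by blast
      moreover have "pair_ideal x y \<noteq> {0}"
        using that(3) pair_ideal_left[of x y] by blast
      moreover have "two_generated R (pair_ideal x y)"
        unfolding two_generated_def using pair_ideal_generated by blast
      ultimately show ?thesis
        using two unfolding w_divisorial_def by blast
    qed
    then show ?thesis
      unfolding t_dimension_one_def using t_prime_height_one w_generated_2_colon_t_Max by blast
  qed
  moreover have "w_divisorial_domain R" if "?dim"
    using that w_divisorial_domainI by blast
  ultimately show ?thesis
    by blast
qed

end
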